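(* Let $A\in\mathbb{R}^{m\times n}$, $0\ne b\in\mathbb{R}^m$, $\mu>0$, let $\ell\ge1$ be an integer, and suppose that $q$ steps of Golub-Kahan bidiagonalization of $A$ with initial vector $b$ give matrices $U_{q+1},V_q,\bar C_q,C_q$ with the properties listed in the context. Let $$y_{\ell,\mu}=\sum_{j=1}^{\ell}\frac{1}{\mu^{j-1}}(\bar C_q^*\bar C_q+\mu^{-1}I)^{-j}\bar C_q^*e_1\|b\|_2$$ and let $x_{\ell,\mu}=V_qy_{\ell,\mu}$. Then $$\|b-Ax_{\ell,\mu}\|_2=\bar\phi_{q+1,\ell}^{1/2}(\mu),\qquad\text{where}\quad \bar\phi_{q+1,\ell}(\mu)=\|b\|_2^2\,e_1^*(\mu\bar C_q\bar C_q^*+I)^{-2\ell}e_1 .$$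
   Context: The superscript $^*$ denotes transposition, $I$ is the identity of suitable order, $\|\cdot\|_2$ is the Euclidean norm, and $e_1=[1,0,\ldots,0]^*$ is the first axis vector of appropriate dimension. Golub-Kahan bidiagonalization: for an integer $q$ with $1\le q<\min\{m,n\}$, one has $$AV_q=U_{q+1}\bar C_q,\qquad A^*U_q=V_qC_q^*,$$ where $U_{q+1}=[u_1,\ldots,u_{q+1}]\in\mathbb{R}^{m\times(q+1)}$ and $V_q=[v_1,\ldots,v_q]\in\mathbb{R}^{n\times q}$ have orthonormal columns, $u_1=b/\|b\|_2$, $U_q$ consists of the first $q$ columns of $U_{q+1}$, and $\bar C_q\in\mathbb{R}^{(q+1)\times q}$ is lower bidiagonal with diagonal entries $(\bar C_q)_{j,j}=\rho_j>0$ ($1\le j\le q$), subdiagonal entries $(\bar C_q)_{j+1,j}=\sigma_{j+1}>0$ ($1\le j\le q$), and all other entries zero. $C_q\in\mathbb{R}^{q\times q}$ consists of the first $q$ rows of $\bar C_q$. *)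

theory Defs
  imports
    Complex_Main
    "Jordan_Normal_Form.Gauss_Jordan_Elimination"
begin

text \<open>Matrices and vectors are those of Jordan_Normal_Form, so the dimensions are natural numbers
  and all indices start at 0: the first axis vector is \<open>unit_vec k 0\<close>, and the first column of
  \<open>U\<close> is \<open>col U 0\<close>.\<close>

definition norm2 :: "real vec \<Rightarrow> real" where
  "norm2 v = sqrt (v \<bullet> v)"

definition orthonormal_cols :: "real mat \<Rightarrow> bool" where
  "orthonormal_cols M \<longleftrightarrow>
     (\<forall>i < dim_col M. \<forall>j < dim_col M. col M i \<bullet> col M j = (if i = j then 1 else 0))"

definition first_cols :: "nat \<Rightarrow> real mat \<Rightarrow> real mat" where
  "first_cols k M = mat (dim_row M) k (\<lambda>(i, j). M $$ (i, j))"

definition first_rows :: "nat \<Rightarrow> real mat \<Rightarrow> real mat" where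
  "first_rows k M = mat k (dim_col M) (\<lambda>(i, j). M $$ (i, j))"

text \<open>The power with exponent \<open>-k\<close>. It is unspecified for a singular argument, because
  \<^const>\<open>mat_inverse\<close> is then \<^const>\<open>None\<close>.\<close>

definition neg_pow_mat :: "real mat \<Rightarrow> nat \<Rightarrow> real mat" where
  "neg_pow_mat M k = the (mat_inverse M) ^\<^sub>m k"

text \<open>A \<open>(q+1) \<times> q\<close> matrix whose diagonal and subdiagonal entries are positive and whose other
  entries vanish.\<close>

definition pos_lower_bidiagonal :: "nat \<Rightarrow> real mat \<Rightarrow> bool" where
  "pos_lower_bidiagonal q C \<longleftrightarrow>
     C \<in> carrier_mat (q + 1) q \<and>
     (\<forall>j < q. C $$ (j, j) > 0 \<and> C $$ (j + 1, j) > 0) \<and>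
     (\<forall>i < q + 1. \<forall>j < q. i \<noteq> j \<longrightarrow> i \<noteq> j + 1 \<longrightarrow> C $$ (i, j) = 0)"

text \<open>In \<open>golub_kahan m n A b q U V C\<close> the matrices \<open>U\<close>, \<open>V\<close> and \<open>C\<close> are
  \<open>U\<^bsub>q+1\<^esub>\<close>, \<open>V\<^bsub>q\<^esub>\<close> and the rectangular \<open>(q+1) \<times> q\<close> bidiagonal matrix; the square one
  consists of its first \<open>q\<close> rows.\<close>

definition golub_kahan ::
  "nat \<Rightarrow> nat \<Rightarrow> real mat \<Rightarrow> real vec \<Rightarrow> nat \<Rightarrow> real mat \<Rightarrow> real mat \<Rightarrow> real mat \<Rightarrow> bool" where
  "golub_kahan m n A b q U V C \<longleftrightarrow>
     1 \<le> q \<and> q < min m n \<and>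
     U \<in> carrier_mat m (q + 1) \<and> orthonormal_cols U \<and>
     V \<in> carrier_mat n q \<and> orthonormal_cols V \<and>
     col U 0 = (1 / norm2 b) \<cdot>\<^sub>v b \<and>
     pos_lower_bidiagonal q C \<and>
     A * V = U * C \<and>
     transpose_mat A * first_cols q U = V * transpose_mat (first_rows q C)"

definition phi_bar :: "real vec \<Rightarrow> nat \<Rightarrow> real mat \<Rightarrow> nat \<Rightarrow> real \<Rightarrow> real" where
  "phi_bar b q C l \<mu> =
     (norm2 b)\<^sup>2 *
     (unit_vec (q + 1) 0 \<bullet>
        (neg_pow_mat (\<mu> \<cdot>\<^sub>m (C * transpose_mat C) + 1\<^sub>m (q + 1)) (2 * l) *\<^sub>v unit_vec (q + 1) 0))"

end

theory Submission
  imports Defs "Jordan_Normal_Form.Determinant"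
begin

text \<open>Put \<open>M = \<mu>CC\<^sup>* + I\<close> and \<open>P = C\<^sup>*C + I/\<mu>\<close>. The push-through identity
  \<open>CP = MC/\<mu>\<close> moves the inverse powers of \<open>P\<close> across \<open>C\<close>, and \<open>\<mu>CC\<^sup>* = M - I\<close> turns the \<open>j\<close>-th
  summand of \<open>Cy\<close> into \<open>M^(-(j-1))e - M^(-j)e\<close>, where \<open>e\<close> is \<open>norm2 b\<close> times the first axis vector.
  The sum telescopes, so that \<open>e - Cy = M^(-l)e\<close>. Since \<open>b - AVy = U(e - Cy)\<close> and \<open>U\<close> has
  orthonormal columns, the residual has the norm of \<open>M^(-l)e\<close>, and \<open>M\<close> is symmetric.\<close>

section \<open>Orthonormal columns and scalar products\<close>

text \<open>The Gram matrix of \<open>U\<close> is the identity, so moving \<open>U\<close> across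
  the scalar product cancels it. This reduces the residual in dimension \<open>m\<close> to one in
  dimension \<open>q + 1\<close>.\<close>

lemma norm2_mult_orthonormal_cols:
  assumes U: "U \<in> carrier_mat m k" and orth: "orthonormal_cols U" and w: "w \<in> carrier_vec k"
  shows "norm2 (U *\<^sub>v w) = norm2 w"
proof -
  have "transpose_mat U * U = 1\<^sub>m k"
    using U orth by (intro eq_matI) (auto simp: orthonormal_cols_def)
  then have "transpose_mat U *\<^sub>v (U *\<^sub>v w) = w"
    using U w by (metis assoc_mult_mat_vec one_mult_mat_vec transpose_carrier_mat)
  then have "(U *\<^sub>v w) \<bullet> (U *\<^sub>v w) = w \<bullet> w"
    using transpose_vec_mult_scalar[OF U w, of "U *\<^sub>v w"] U w
    by (metis comm_scalar_prod mult_mat_vec_carrier)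
  then show ?thesis by (simp add: norm2_def)
qed

lemma scalar_prod_self_nonneg: "0 \<le> v \<bullet> (v :: real vec)"
  by (simp add: scalar_prod_def sum_nonneg)

lemma scalar_prod_self_eq_0:
  assumes "v \<in> carrier_vec n" "v \<bullet> (v :: real vec) = 0"
  shows "v = 0\<^sub>v n"
  using assms by (intro eq_vecI) (auto simp: scalar_prod_def sum_nonneg_eq_0_iff)

lemma smult_mat_mult_vec:
  fixes A :: "'a :: comm_semiring_0 mat"
  assumes "A \<in> carrier_mat nr nc" "v \<in> carrier_vec nc"
  shows "(k \<cdot>\<^sub>m A) *\<^sub>v v = k \<cdot>\<^sub>v (A *\<^sub>v v)"
  using assms by (intro eq_vecI) auto

section \<open>Shifted Gram matrices: symmetry and invertibility\<close>

lemma transpose_shifted_gram: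
  assumes "(B :: real mat) \<in> carrier_mat r s"
  shows "transpose_mat (a \<cdot>\<^sub>m (transpose_mat B * B) + c \<cdot>\<^sub>m 1\<^sub>m s)
    = a \<cdot>\<^sub>m (transpose_mat B * B) + c \<cdot>\<^sub>m 1\<^sub>m s"
  using assms by (intro eq_matI) (auto intro!: comm_scalar_prod[of _ r])

text \<open>Positive definiteness: a kernel vector \<open>v\<close> gives
  \<open>a * |B v|^2 + c * |v|^2 = 0\<close>, hence \<open>v = 0\<close>. The lemma serves both
  inverses of the proof, and it guarantees that \<open>the\<close> in \<open>neg_pow_mat\<close>
  meets a genuine inverse.\<close>

lemma mat_inverse_shifted_gram:
  fixes B :: "real mat" and a c :: real
  assumes B: "B \<in> carrier_mat r s" and a: "a \<ge> 0" and c: "c > 0"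
  defines "M \<equiv> a \<cdot>\<^sub>m (transpose_mat B * B) + c \<cdot>\<^sub>m 1\<^sub>m s"
  shows "the (mat_inverse M) \<in> carrier_mat s s"
    and "M * the (mat_inverse M) = 1\<^sub>m s"
    and "the (mat_inverse M) * M = 1\<^sub>m s"
proof -
  have M: "M \<in> carrier_mat s s" using B by (simp add: M_def)
  have "det M \<noteq> 0"
  proof
    assume "det M = 0"
    then obtain v where v: "v \<in> carrier_vec s" "v \<noteq> 0\<^sub>v s" and Mv: "M *\<^sub>v v = 0\<^sub>v s"
      using det_0_iff_vec_prod_zero[OF M] by auto
    have "M *\<^sub>v v = a \<cdot>\<^sub>v (transpose_mat B *\<^sub>v (B *\<^sub>v v)) + c \<cdot>\<^sub>v v"
    proof -
      have "(a \<cdot>\<^sub>m (transpose_mat B * B)) *\<^sub>v v = a \<cdot>\<^sub>v ((transpose_mat B * B) *\<^sub>v v)"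
        using B v by (intro smult_mat_mult_vec) auto
      moreover have "(c \<cdot>\<^sub>m 1\<^sub>m s) *\<^sub>v v = c \<cdot>\<^sub>v v"
        using v by (intro eq_vecI) auto
      moreover have "(transpose_mat B * B) *\<^sub>v v = transpose_mat B *\<^sub>v (B *\<^sub>v v)"
        using B v by (intro assoc_mult_mat_vec) auto
      ultimately show ?thesis
        unfolding M_def using B v by (subst add_mult_distrib_mat_vec[of _ s s]) auto
    qed
    then have "(M *\<^sub>v v) \<bullet> v = a * ((transpose_mat B *\<^sub>v (B *\<^sub>v v)) \<bullet> v) + c * (v \<bullet> v)"
      using B v by (simp add: add_scalar_prod_distrib[of _ s])
    also have "(transpose_mat B *\<^sub>v (B *\<^sub>v v)) \<bullet> v = (B *\<^sub>v v) \<bullet> (B *\<^sub>v v)"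
      using transpose_vec_mult_scalar[OF B v(1), of "B *\<^sub>v v"] B v by simp
    finally have "a * ((B *\<^sub>v v) \<bullet> (B *\<^sub>v v)) + c * (v \<bullet> v) = 0"
      using Mv v by simp
    then have "c * (v \<bullet> v) \<le> 0"
      using mult_nonneg_nonneg[OF a scalar_prod_self_nonneg[of "B *\<^sub>v v"]] by linarith
    with c have "v \<bullet> v = 0"
      using scalar_prod_self_nonneg[of v] by (simp add: mult_le_0_iff)
    with v show False using scalar_prod_self_eq_0 by blast
  qed
  then have "M \<in> Units (ring_mat TYPE(real) s ())"
    by (rule det_non_zero_imp_unit[OF M])
  then obtain W where "mat_inverse M = Some W"
    using mat_inverse(1)[OF M, of "()"] by (cases "mat_inverse M") auto
  with mat_inverse(2)[OF M this]
  show "the (mat_inverse M) \<in> carrier_mat s s" "M * the (mat_inverse M) = 1\<^sub>m s"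
    "the (mat_inverse M) * M = 1\<^sub>m s" by auto
qed

text \<open>Transposing \<open>M * W = 1\<close> makes the transpose of \<open>W\<close> a left
  inverse of \<open>M\<close>, and a left inverse coincides with a right inverse.\<close>

lemma transpose_inverse_symmetric:
  fixes M W :: "real mat"
  assumes M: "M \<in> carrier_mat n n" and W: "W \<in> carrier_mat n n"
    and MW: "M * W = 1\<^sub>m n" and sym: "transpose_mat M = M"
  shows "transpose_mat W = W"
proof -
  have "transpose_mat W * M = 1\<^sub>m n"
    using transpose_mult[OF M W] MW sym by simp
  then have "transpose_mat W * (M * W) = W"
    using M W by (metis assoc_mult_mat left_mult_one_mat transpose_carrier_mat)
  then show ?thesis using MW W by simp
qed

section \<open>Powers of matrices\<close>

lemma pow_mat_add:
  fixes S :: "'a :: semiring_1 mat"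
  assumes "S \<in> carrier_mat n n"
  shows "S ^\<^sub>m (j + k) = S ^\<^sub>m j * S ^\<^sub>m k"
proof (induction k)
  case (Suc k)
  then show ?case
    using assms by (simp add: assoc_mult_mat[of _ n n _ n _ n] pow_carrier_mat)
qed (use assms in auto)

lemma transpose_pow_mat:
  fixes S :: "'a :: comm_semiring_1 mat"
  assumes S: "S \<in> carrier_mat n n" and sym: "transpose_mat S = S"
  shows "transpose_mat (S ^\<^sub>m k) = S ^\<^sub>m k"
proof (induction k)
  case (Suc k)
  have "transpose_mat (S ^\<^sub>m Suc k) = S * S ^\<^sub>m k"
    using transpose_mult[OF pow_carrier_mat[OF S, of k] S] Suc sym by simp
  \<comment> \<open>\<open>pow_mat\<close> appends factors on the right; splitting the exponent as
    \<open>1 + k\<close> gives the form with \<open>S\<close> in front.\<close>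
  also have "\<dots> = S ^\<^sub>m Suc k"
    using pow_mat_add[OF S, of 1 k] S by simp
  finally show ?case .
qed (use S in auto)

text \<open>By symmetry one copy of the power crosses the scalar product and joins the other, which
  is the origin of the exponent \<open>2 * l\<close> in \<open>phi_bar\<close>.\<close>

lemma norm2_pow_mat_mult:
  assumes S: "S \<in> carrier_mat n n" and sym: "transpose_mat S = S" and v: "v \<in> carrier_vec n"
  shows "norm2 (S ^\<^sub>m k *\<^sub>v v) = sqrt (v \<bullet> (S ^\<^sub>m (2 * k) *\<^sub>v v))"
proof -
  have Sk: "S ^\<^sub>m k \<in> carrier_mat n n" using S by (rule pow_carrier_mat)
  have "(S ^\<^sub>m k *\<^sub>v v) \<bullet> (S ^\<^sub>m k *\<^sub>v v) = (S ^\<^sub>m k *\<^sub>v (S ^\<^sub>m k *\<^sub>v v)) \<bullet> v"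
    using transpose_vec_mult_scalar[OF Sk v, of "S ^\<^sub>m k *\<^sub>v v"] Sk v
      transpose_pow_mat[OF S sym] by simp
  also have "\<dots> = v \<bullet> (S ^\<^sub>m k *\<^sub>v (S ^\<^sub>m k *\<^sub>v v))"
    using Sk v by (intro comm_scalar_prod[of _ n]) auto
  also have "S ^\<^sub>m k *\<^sub>v (S ^\<^sub>m k *\<^sub>v v) = S ^\<^sub>m (2 * k) *\<^sub>v v"
    using pow_mat_add[OF S, of k k] assoc_mult_mat_vec[OF Sk Sk v] by (simp add: mult_2)
  finally show ?thesis by (simp add: norm2_def)
qed

section \<open>Push-through identity and telescoping sum\<close>

text \<open>Each factor \<open>R\<close> that passes \<open>C\<close> from right to left turns into
  \<mu> times \<open>W\<close>. Here \<open>R\<close> and \<open>W\<close> will be the inverses of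
  \<open>P\<close> and \<open>M\<close>.\<close>

lemma push_through_pow_mat:
  fixes C R W :: "'a :: comm_semiring_1 mat"
  assumes C: "C \<in> carrier_mat r s" and R: "R \<in> carrier_mat s s" and W: "W \<in> carrier_mat r r"
    and CR: "C * R = \<mu> \<cdot>\<^sub>m (W * C)"
  shows "C * R ^\<^sub>m k = \<mu> ^ k \<cdot>\<^sub>m (W ^\<^sub>m k * C)"
proof (induction k)
  case 0
  then show ?case using C R W by auto
next
  case (Suc k)
  note Rk = pow_carrier_mat[OF R, of k] and Wk = pow_carrier_mat[OF W, of k]
  have "C * R ^\<^sub>m Suc k = (C * R ^\<^sub>m k) * R"
    using assoc_mult_mat[OF C Rk R] by simp
  also have "\<dots> = \<mu> ^ k \<cdot>\<^sub>m (W ^\<^sub>m k * (C * R))"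
    using Suc mult_smult_assoc_mat[OF mult_carrier_mat[OF Wk C] R] assoc_mult_mat[OF Wk C R]
    by simp
  also have "\<dots> = \<mu> ^ k \<cdot>\<^sub>m (\<mu> \<cdot>\<^sub>m (W ^\<^sub>m k * (W * C)))"
    using CR mult_smult_distrib[OF Wk mult_carrier_mat[OF W C]] by simp
  also have "W ^\<^sub>m k * (W * C) = W ^\<^sub>m Suc k * C"
    using assoc_mult_mat[OF Wk W C] by simp
  also have "\<mu> ^ k \<cdot>\<^sub>m (\<mu> \<cdot>\<^sub>m (W ^\<^sub>m Suc k * C)) = \<mu> ^ Suc k \<cdot>\<^sub>m (W ^\<^sub>m Suc k * C)"
    by (intro eq_matI) (auto simp: mult_ac)
  finally show ?case .
qed

text \<open>The sum is the iterate number \<open>l\<close> of iterated Tikhonov regularization,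
  started at zero, for the system with matrix \<open>C\<close> and right-hand side \<open>e\<close>.
  Each iteration multiplies the residual by the inverse of \<open>M\<close>.\<close>

lemma residual_projected_iterated_tikhonov:
  fixes C :: "real mat" and \<mu> :: real
  assumes C: "C \<in> carrier_mat r s" and \<mu>: "\<mu> > 0" and e: "e \<in> carrier_vec r"
  defines "P \<equiv> transpose_mat C * C + (1 / \<mu>) \<cdot>\<^sub>m 1\<^sub>m s"
    and "M \<equiv> \<mu> \<cdot>\<^sub>m (C * transpose_mat C) + 1\<^sub>m r"
  shows "e - C *\<^sub>v finsum_vec TYPE(real) s
      (\<lambda>j. (1 / \<mu> ^ (j - 1)) \<cdot>\<^sub>v (neg_pow_mat P j *\<^sub>v (transpose_mat C *\<^sub>v e))) {1..l}
    = neg_pow_mat M l *\<^sub>v e"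
proof -
  define R where "R = the (mat_inverse P)"
  define W where "W = the (mat_inverse M)"
  let ?T = "transpose_mat C"
  have T: "?T \<in> carrier_mat s r" using C by simp
  have P: "P \<in> carrier_mat s s" and M: "M \<in> carrier_mat r r"
    using C by (auto simp: P_def M_def)
  have "P = 1 \<cdot>\<^sub>m (?T * C) + (1 / \<mu>) \<cdot>\<^sub>m 1\<^sub>m s"
    unfolding P_def using C by (intro eq_matI) auto
  then have R: "R \<in> carrier_mat s s" "P * R = 1\<^sub>m s"
    using mat_inverse_shifted_gram[OF C, of 1 "1 / \<mu>"] \<mu> by (auto simp: R_def)
  \<comment> \<open>Read as a shifted Gram matrix of \<open>?T\<close> instead of \<open>C\<close>,
    \<open>M\<close> falls under the same invertibility lemma as \<open>P\<close>.\<close>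
  have "M = \<mu> \<cdot>\<^sub>m (transpose_mat ?T * ?T) + 1 \<cdot>\<^sub>m 1\<^sub>m r"
    unfolding M_def by (intro eq_matI) auto
  then have W: "W \<in> carrier_mat r r" "W * M = 1\<^sub>m r"
    using mat_inverse_shifted_gram[OF T, of \<mu> 1] \<mu> by (auto simp: W_def)
  \<comment> \<open>Both sides expand to \<open>\<mu> C ?T C + C\<close>; the shift
    \<open>1 / \<mu>\<close> in \<open>P\<close> is what makes the linear terms agree.\<close>
  have MC: "M * C = \<mu> \<cdot>\<^sub>m (C * P)"
  proof -
    have "M * C = \<mu> \<cdot>\<^sub>m (C * ?T) * C + 1\<^sub>m r * C"
      unfolding M_def using C by (intro add_mult_distrib_mat) auto
    also have "\<mu> \<cdot>\<^sub>m (C * ?T) * C = \<mu> \<cdot>\<^sub>m (C * (?T * C))"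
      using C by (simp add: mult_smult_assoc_mat[of _ r r] assoc_mult_mat[OF C T C])
    also have "C * (?T * C) = C * P - (1 / \<mu>) \<cdot>\<^sub>m C"
    proof -
      have "C * P = C * (?T * C) + C * ((1 / \<mu>) \<cdot>\<^sub>m 1\<^sub>m s)"
        unfolding P_def using C by (intro mult_add_distrib_mat) auto
      also have "C * ((1 / \<mu>) \<cdot>\<^sub>m 1\<^sub>m s) = (1 / \<mu>) \<cdot>\<^sub>m C"
        using C mult_smult_distrib[OF C one_carrier_mat] by simp
      finally show ?thesis using C by (intro eq_matI) auto
    qed
    finally show ?thesis
      using C P \<mu> by (intro eq_matI) (auto simp: field_simps)
  qed
  \<comment> \<open>Multiply \<open>MC\<close> by \<open>W\<close> on the left and by
    \<open>R\<close> on the right.\<close>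
  have CR: "C * R = \<mu> \<cdot>\<^sub>m (W * C)"
  proof -
    have "C * R = W * (M * C) * R"
      using C W M by (simp add: assoc_mult_mat[OF W(1) M C, symmetric])
    also have "\<dots> = \<mu> \<cdot>\<^sub>m (W * (C * P) * R)"
      using mult_smult_distrib[OF W(1) mult_carrier_mat[OF C P], of \<mu>]
        mult_smult_assoc_mat[OF mult_carrier_mat[OF W(1) mult_carrier_mat[OF C P]] R(1), of \<mu>]
      by (simp add: MC)
    also have "W * (C * P) * R = W * (C * (P * R))"
      using C W P R(1) by (simp add: assoc_mult_mat[of _ r _ _ s _ s] assoc_mult_mat[OF C P R(1)])
    also have "\<dots> = W * C" using C R by simp
    finally show ?thesis .
  qed
  let ?t = "\<lambda>j. (1 / \<mu> ^ (j - 1)) \<cdot>\<^sub>v (R ^\<^sub>m j *\<^sub>v (?T *\<^sub>v e))"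
  have t: "?t j \<in> carrier_vec s" for j
    using pow_carrier_mat[OF R(1), of j] T e by auto
  \<comment> \<open>With index \<open>Suc k\<close> the truncated exponent \<open>j - 1\<close> is
    exactly \<open>k\<close>. Pushing through yields \<open>\<mu> ^ Suc k\<close>, so one factor
    \<mu> survives the weight and completes \<open>C ?T e\<close> to \<open>M e - e\<close>.\<close>
  have step: "C *\<^sub>v ?t (Suc k) = W ^\<^sub>m k *\<^sub>v e - W ^\<^sub>m Suc k *\<^sub>v e" for k
  proof -
    note Rk = pow_carrier_mat[OF R(1), of "Suc k"] and Wk = pow_carrier_mat[OF W(1), of "Suc k"]
    have Te: "?T *\<^sub>v e \<in> carrier_vec s" and CTe: "C *\<^sub>v (?T *\<^sub>v e) \<in> carrier_vec r"
      using C T e by auto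
    have "C *\<^sub>v ?t (Suc k) = (1 / \<mu> ^ k) \<cdot>\<^sub>v ((C * R ^\<^sub>m Suc k) *\<^sub>v (?T *\<^sub>v e))"
      using mult_mat_vec[OF C] assoc_mult_mat_vec[OF C Rk Te] Rk Te by simp
    also have "(C * R ^\<^sub>m Suc k) *\<^sub>v (?T *\<^sub>v e) = \<mu> ^ Suc k \<cdot>\<^sub>v ((W ^\<^sub>m Suc k * C) *\<^sub>v (?T *\<^sub>v e))"
      unfolding push_through_pow_mat[OF C R(1) W(1) CR]
      using mult_carrier_mat[OF Wk C] Te by (intro eq_vecI) auto
    also have "(W ^\<^sub>m Suc k * C) *\<^sub>v (?T *\<^sub>v e) = W ^\<^sub>m Suc k *\<^sub>v (C *\<^sub>v (?T *\<^sub>v e))"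
      using assoc_mult_mat_vec[OF Wk C Te] .
    also have "(1 / \<mu> ^ k) \<cdot>\<^sub>v (\<mu> ^ Suc k \<cdot>\<^sub>v (W ^\<^sub>m Suc k *\<^sub>v (C *\<^sub>v (?T *\<^sub>v e))))
        = W ^\<^sub>m Suc k *\<^sub>v (\<mu> \<cdot>\<^sub>v (C *\<^sub>v (?T *\<^sub>v e)))"
      using mult_mat_vec[OF Wk CTe] \<mu> by (simp add: smult_smult_assoc del: pow_mat.simps)
    also have "\<mu> \<cdot>\<^sub>v (C *\<^sub>v (?T *\<^sub>v e)) = M *\<^sub>v e - e"
    proof -
      have "M *\<^sub>v e = (\<mu> \<cdot>\<^sub>m (C * ?T)) *\<^sub>v e + 1\<^sub>m r *\<^sub>v e"
        unfolding M_def using C e by (intro add_mult_distrib_mat_vec) auto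
      also have "(\<mu> \<cdot>\<^sub>m (C * ?T)) *\<^sub>v e = \<mu> \<cdot>\<^sub>v ((C * ?T) *\<^sub>v e)"
        using C e by (intro smult_mat_mult_vec) auto
      also have "(C * ?T) *\<^sub>v e = C *\<^sub>v (?T *\<^sub>v e)"
        using assoc_mult_mat_vec[OF C T e] .
      finally show ?thesis using C e by (intro eq_vecI) auto
    qed
    also have "W ^\<^sub>m Suc k *\<^sub>v (M *\<^sub>v e - e) = W ^\<^sub>m Suc k *\<^sub>v (M *\<^sub>v e) - W ^\<^sub>m Suc k *\<^sub>v e"
      using M e by (intro mult_minus_distrib_mat_vec[OF Wk]) auto
    also have "W ^\<^sub>m Suc k *\<^sub>v (M *\<^sub>v e) = W ^\<^sub>m k *\<^sub>v e"
    proof -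
      note Wk' = pow_carrier_mat[OF W(1), of k]
      have "W ^\<^sub>m Suc k *\<^sub>v (M *\<^sub>v e) = (W ^\<^sub>m k * (W * M)) *\<^sub>v e"
        using assoc_mult_mat_vec[OF Wk M e] assoc_mult_mat[OF Wk' W(1) M] by simp
      then show ?thesis using W Wk' by simp
    qed
    finally show ?thesis .
  qed
  \<comment> \<open>Telescoping by induction; for \<open>l = 0\<close> the empty sum is the zero
    vector and \<open>W ^\<^sub>m 0\<close> is the identity.\<close>
  have "C *\<^sub>v finsum_vec TYPE(real) s ?t {1..l} = e - W ^\<^sub>m l *\<^sub>v e"
  proof (induction l)
    case 0
    then show ?case using C W e by (auto simp: finsum_vec_empty)
  next
    case (Suc l)
    have sum: "finsum_vec TYPE(real) s ?t {1..l} \<in> carrier_vec s"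
      using t by (intro finsum_vec_closed) auto
    have "finsum_vec TYPE(real) s ?t {1..Suc l}
        = ?t (Suc l) + finsum_vec TYPE(real) s ?t {1..l}"
      using t finsum_vec_insert[of "{1..l}" "Suc l" ?t s]
      by (simp add: atLeastAtMostSuc_conv Pi_def del: pow_mat.simps)
    then have "C *\<^sub>v finsum_vec TYPE(real) s ?t {1..Suc l}
        = C *\<^sub>v ?t (Suc l) + C *\<^sub>v finsum_vec TYPE(real) s ?t {1..l}"
      using mult_add_distrib_mat_vec[OF C t[of "Suc l"] sum] by (simp only:)
    also have "\<dots> = (W ^\<^sub>m l *\<^sub>v e - W ^\<^sub>m Suc l *\<^sub>v e) + (e - W ^\<^sub>m l *\<^sub>v e)"
      using step[of l] Suc by (simp only:)
    also have "\<dots> = e - W ^\<^sub>m Suc l *\<^sub>v e"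
      using W e by (intro eq_vecI) auto
    finally show ?case .
  qed
  then show ?thesis
    unfolding neg_pow_mat_def R_def[symmetric] W_def[symmetric]
    using e W by (intro eq_vecI) auto
qed

section \<open>From the projected residual to the full one\<close>

theorem theorem11:
  fixes m n q l :: nat and A U V C :: "real mat" and b x y :: "real vec" and \<mu> :: real
  assumes "A \<in> carrier_mat m n"
    and "b \<in> carrier_vec m" and "b \<noteq> 0\<^sub>v m"
    and "\<mu> > 0"
    and "l \<ge> 1"
    and "golub_kahan m n A b q U V C"
    and "y = finsum_vec TYPE(real) q
           (\<lambda>j. (1 / \<mu> ^ (j - 1)) \<cdot>\<^sub>v
              (neg_pow_mat (transpose_mat C * C + (1 / \<mu>) \<cdot>\<^sub>m 1\<^sub>m q) j *\<^sub>v
                (transpose_mat C *\<^sub>v (norm2 b \<cdot>\<^sub>v unit_vec (q + 1) 0))))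
           {1..l}"
    and "x = V *\<^sub>v y"
  shows "norm2 (b - A *\<^sub>v x) = sqrt (phi_bar b q C l \<mu>)"
proof -
  let ?e = "unit_vec (q + 1) 0 :: real vec"
  let ?M = "\<mu> \<cdot>\<^sub>m (C * transpose_mat C) + 1\<^sub>m (q + 1)"
  define \<beta> where "\<beta> = norm2 b"
  define W where "W = the (mat_inverse ?M)"
  have U: "U \<in> carrier_mat m (q + 1)" "orthonormal_cols U" and V: "V \<in> carrier_mat n q"
    and C: "C \<in> carrier_mat (q + 1) q" and AV: "A * V = U * C"
    and U0: "col U 0 = (1 / \<beta>) \<cdot>\<^sub>v b"
    using assms(6) by (auto simp: golub_kahan_def pos_lower_bidiagonal_def \<beta>_def)
  have "b \<bullet> b \<noteq> 0" using scalar_prod_self_eq_0 assms(2,3) by blast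
  then have \<beta>: "\<beta> > 0"
    using scalar_prod_self_nonneg[of b] by (simp add: \<beta>_def norm2_def)
  have T: "transpose_mat C \<in> carrier_mat q (q + 1)" using C by simp
  have M: "?M \<in> carrier_mat (q + 1) (q + 1)" using C by simp
  have M_eq: "?M = \<mu> \<cdot>\<^sub>m (transpose_mat (transpose_mat C) * transpose_mat C) + 1 \<cdot>\<^sub>m 1\<^sub>m (q + 1)"
    by (intro eq_matI) auto
  have W: "W \<in> carrier_mat (q + 1) (q + 1)" "?M * W = 1\<^sub>m (q + 1)"
    using mat_inverse_shifted_gram[OF T, of \<mu> 1] assms(4) unfolding W_def M_eq by auto
  have "transpose_mat ?M = ?M"
    unfolding M_eq by (rule transpose_shifted_gram[OF T])
  then have W_sym: "transpose_mat W = W"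
    using transpose_inverse_symmetric[OF M W] by blast
  \<comment> \<open>The dimension of \<open>y\<close> depends on the inverse being defined: only
    then is every summand known to lie in \<open>carrier_vec q\<close>.\<close>
  have y: "y \<in> carrier_vec q"
  proof -
    have "the (mat_inverse (transpose_mat C * C + (1 / \<mu>) \<cdot>\<^sub>m 1\<^sub>m q)) \<in> carrier_mat q q"
    proof -
      have "transpose_mat C * C + (1 / \<mu>) \<cdot>\<^sub>m 1\<^sub>m q
          = 1 \<cdot>\<^sub>m (transpose_mat C * C) + (1 / \<mu>) \<cdot>\<^sub>m 1\<^sub>m q"
        using C by (intro eq_matI) auto
      then show ?thesis
        using mat_inverse_shifted_gram(1)[OF C, of 1 "1 / \<mu>"] assms(4) by simp
    qed
    then show ?thesis
      unfolding assms(7) neg_pow_mat_def using C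
      by (intro finsum_vec_closed funcsetI smult_carrier_vec[THEN iffD2]
          mult_mat_vec_carrier[OF pow_carrier_mat]) auto
  qed
  \<comment> \<open>Since the first column of \<open>U\<close> is \<open>b\<close> divided by
    \<beta>, \<open>b\<close> lies in the range of \<open>U\<close>. As
    \<open>A * V = U * C\<close>, so does the whole residual.\<close>
  have "U *\<^sub>v ?e = col U 0"
    using U(1) by (intro eq_vecI) auto
  then have "U *\<^sub>v (\<beta> \<cdot>\<^sub>v ?e) = b"
    using U0 \<beta> mult_mat_vec[OF U(1)] by (simp add: smult_smult_assoc)
  moreover have "A *\<^sub>v x = U *\<^sub>v (C *\<^sub>v y)"
    using assoc_mult_mat_vec[OF assms(1) V y] assoc_mult_mat_vec[OF U(1) C y] AV assms(8) by simp
  ultimately have "b - A *\<^sub>v x = U *\<^sub>v (\<beta> \<cdot>\<^sub>v ?e - C *\<^sub>v y)"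
    using mult_minus_distrib_mat_vec[OF U(1), of "\<beta> \<cdot>\<^sub>v ?e" "C *\<^sub>v y"] C y by simp
  also have "\<beta> \<cdot>\<^sub>v ?e - C *\<^sub>v y = W ^\<^sub>m l *\<^sub>v (\<beta> \<cdot>\<^sub>v ?e)"
    using residual_projected_iterated_tikhonov[OF C assms(4), of "\<beta> \<cdot>\<^sub>v ?e" l]
    unfolding assms(7) \<beta>_def W_def by (simp add: neg_pow_mat_def)
  finally have "norm2 (b - A *\<^sub>v x) = norm2 (W ^\<^sub>m l *\<^sub>v (\<beta> \<cdot>\<^sub>v ?e))"
    using norm2_mult_orthonormal_cols[OF U, of "W ^\<^sub>m l *\<^sub>v (\<beta> \<cdot>\<^sub>v ?e)"]
      pow_carrier_mat[OF W(1), of l] by simp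
  also have "\<dots> = sqrt ((\<beta> \<cdot>\<^sub>v ?e) \<bullet> (W ^\<^sub>m (2 * l) *\<^sub>v (\<beta> \<cdot>\<^sub>v ?e)))"
    using norm2_pow_mat_mult[OF W(1) W_sym] by simp
  \<comment> \<open>One \<beta> leaves each argument of the scalar product, giving the squared norm
    of \<open>b\<close> in \<open>phi_bar\<close>.\<close>
  also have "(\<beta> \<cdot>\<^sub>v ?e) \<bullet> (W ^\<^sub>m (2 * l) *\<^sub>v (\<beta> \<cdot>\<^sub>v ?e)) = \<beta>\<^sup>2 * (?e \<bullet> (W ^\<^sub>m (2 * l) *\<^sub>v ?e))"
    using pow_carrier_mat[OF W(1), of "2 * l"] mult_mat_vec[of "W ^\<^sub>m (2 * l)" "q + 1" "q + 1" ?e \<beta>]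
      scalar_prod_smult_left[of ?e "W ^\<^sub>m (2 * l) *\<^sub>v ?e" \<beta>] W(1)
    by (simp add: power2_eq_square)
  finally show ?thesis
    by (simp add: phi_bar_def neg_pow_mat_def \<beta>_def W_def)
qed

end
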